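(* Let $(Y,d)$ be a $1$-bounded pseudo-metric space and let $\precsim$ be a preorder on $Y$. Then the function $d^1_\precsim: Y\times Y\to\mathbb{R}^{+}$ defined by $$d^1_\precsim(x,y)=\begin{cases} d(x,y), & x\precsim y,\\ 1, & \text{otherwise,}\end{cases}$$ is a quasi-pseudo-metric such that $\tau_{d^1_\precsim}$ is finer than $\tau_A^{\precsim}$. Therefore, $\precsim$ is lower $\tau_{d^1_\precsim}$-continuous. If $d$ is a metric on $Y$, then $d^1_\precsim$ is a $T_1$ quasi-metric.
   Context: $\mathbb{R}^+=[0,\infty)$. A pseudo-metric space $(Y,d)$ is $1$-bounded if $d(x,y)\le 1$ for all $x,y\in Y$. A preorder is a reflexive transitive relation. A quasi-pseudo-metric on a non-empty set $Y$ is a function $q:Y\times Y\to\mathbb{R}^+$ with $q(x,x)=0$ and $q(x,z)\le q(x,y)+q(y,z)$; it induces the topology $\tau_q$ with base the balls $B_q(x,\varepsilon)=\{y\in Y: q(x,y)<\varepsilon\}$, $\varepsilon>0$. A quasi-metric is a quasi-pseudo-metric with $q(x,y)=q(y,x)=0\Leftrightarrow x=y$; it is $T_1$ if moreover $q(x,y)=0\Leftrightarrow x=y$. The Alexandroff topology $\tau_A^{\precsim}$ consists of all up-sets of $\precsim$, i.e. sets $G\subseteq Y$ such that $x\in G$ and $x\precsim y$ imply $y\in G$. $\precsim$ is lower $\tau$-continuous if $\{x\in Y: x\precsim y\}$ is $\tau$-closed for every $y\in Y$. "$\tau$ finer than $\tau'$" means $\tau'\subseteq\tau$. *)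

theory Defs
  imports "HOL-Analysis.Analysis"
begin

definition pseudo_metric_on :: "'a set \<Rightarrow> ('a \<Rightarrow> 'a \<Rightarrow> real) \<Rightarrow> bool" where
  "pseudo_metric_on Y d \<longleftrightarrow>
     (\<forall>x\<in>Y. \<forall>y\<in>Y. 0 \<le> d x y) \<and>
     (\<forall>x\<in>Y. d x x = 0) \<and>
     (\<forall>x\<in>Y. \<forall>y\<in>Y. d x y = d y x) \<and>
     (\<forall>x\<in>Y. \<forall>y\<in>Y. \<forall>z\<in>Y. d x z \<le> d x y + d y z)"

text \<open>
  The locale \<open>Metric_space\<close> demands non-negativity and symmetry also outside the carrier.
  The following predicate only looks at the values of \<open>d\<close> on \<open>Y \<times> Y\<close>; the two notions
  differ in nothing else, see \<open>metric_on_iff_Metric_space\<close>.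
\<close>

definition metric_on :: "'a set \<Rightarrow> ('a \<Rightarrow> 'a \<Rightarrow> real) \<Rightarrow> bool" where
  "metric_on Y d \<longleftrightarrow>
     pseudo_metric_on Y d \<and> (\<forall>x\<in>Y. \<forall>y\<in>Y. d x y = 0 \<longrightarrow> x = y)"

lemma metric_on_iff_Metric_space:
  "metric_on Y d \<longleftrightarrow> Metric_space Y (\<lambda>x y. if x \<in> Y \<and> y \<in> Y then d x y else 0)"
  (is "_ \<longleftrightarrow> Metric_space Y ?d")
proof
  assume "metric_on Y d"
  then show "Metric_space Y ?d"
    unfolding metric_on_def pseudo_metric_on_def by unfold_locales auto
next
  assume "Metric_space Y ?d"
  then interpret Metric_space Y ?d .
  have "0 \<le> d x y" "d x x = 0" "d x y = d y x" "d x y = 0 \<longrightarrow> x = y"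
    if "x \<in> Y" "y \<in> Y" for x y
    using that nonneg[of x y] zero[of x x] zero[of x y] commute[of x y] by auto
  moreover have "d x z \<le> d x y + d y z" if "x \<in> Y" "y \<in> Y" "z \<in> Y" for x y z
    using that triangle[of x y z] by auto
  ultimately show "metric_on Y d"
    unfolding metric_on_def pseudo_metric_on_def by blast
qed

definition one_bounded_on :: "'a set \<Rightarrow> ('a \<Rightarrow> 'a \<Rightarrow> real) \<Rightarrow> bool" where
  "one_bounded_on Y d \<longleftrightarrow> (\<forall>x\<in>Y. \<forall>y\<in>Y. d x y \<le> 1)"

definition quasi_pseudo_metric_on :: "'a set \<Rightarrow> ('a \<Rightarrow> 'a \<Rightarrow> real) \<Rightarrow> bool" where
  "quasi_pseudo_metric_on Y q \<longleftrightarrow>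
     Y \<noteq> {} \<and>
     (\<forall>x\<in>Y. \<forall>y\<in>Y. 0 \<le> q x y) \<and>
     (\<forall>x\<in>Y. q x x = 0) \<and>
     (\<forall>x\<in>Y. \<forall>y\<in>Y. \<forall>z\<in>Y. q x z \<le> q x y + q y z)"

definition quasi_metric_on :: "'a set \<Rightarrow> ('a \<Rightarrow> 'a \<Rightarrow> real) \<Rightarrow> bool" where
  "quasi_metric_on Y q \<longleftrightarrow>
     quasi_pseudo_metric_on Y q \<and>
     (\<forall>x\<in>Y. \<forall>y\<in>Y. (q x y = 0 \<and> q y x = 0) \<longleftrightarrow> x = y)"

definition T1_quasi_metric_on :: "'a set \<Rightarrow> ('a \<Rightarrow> 'a \<Rightarrow> real) \<Rightarrow> bool" where
  "T1_quasi_metric_on Y q \<longleftrightarrow>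
     quasi_metric_on Y q \<and> (\<forall>x\<in>Y. \<forall>y\<in>Y. q x y = 0 \<longleftrightarrow> x = y)"

definition qball :: "'a set \<Rightarrow> ('a \<Rightarrow> 'a \<Rightarrow> real) \<Rightarrow> 'a \<Rightarrow> real \<Rightarrow> 'a set" where
  "qball Y q x \<epsilon> = {y \<in> Y. q x y < \<epsilon>}"

text \<open>
  The operator \<open>topology\<close> is only meaningful for predicates satisfying \<open>istopology\<close>.
  For the topology with base the balls this holds as soon as \<open>q\<close> is a
  quasi-pseudo-metric (\<open>openin_qtopology\<close>), for the up-sets it always holds
  (\<open>openin_alexandroff\<close>).
\<close>

definition qtopology :: "'a set \<Rightarrow> ('a \<Rightarrow> 'a \<Rightarrow> real) \<Rightarrow> 'a topology" where
  "qtopology Y q =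
     topology (arbitrary union_of (\<lambda>B. \<exists>x\<in>Y. \<exists>\<epsilon>>0. B = qball Y q x \<epsilon>))"

definition alexandroff :: "'a set \<Rightarrow> 'a rel \<Rightarrow> 'a topology" where
  "alexandroff Y r =
     topology (\<lambda>G. G \<subseteq> Y \<and> (\<forall>x\<in>G. \<forall>y\<in>Y. (x, y) \<in> r \<longrightarrow> y \<in> G))"

definition finer_topology :: "'a topology \<Rightarrow> 'a topology \<Rightarrow> bool" where
  "finer_topology S T \<longleftrightarrow>
     topspace S = topspace T \<and> (\<forall>G. openin T G \<longrightarrow> openin S G)"

definition lower_continuous :: "'a set \<Rightarrow> 'a topology \<Rightarrow> 'a rel \<Rightarrow> bool" where
  "lower_continuous Y T r \<longleftrightarrow> (\<forall>y\<in>Y. closedin T {x \<in> Y. (x, y) \<in> r})"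

text \<open>Pairs \<open>(x, y) \<in> r\<close> encode \<open>x\<close> below \<open>y\<close> in the preorder.\<close>

definition d1 :: "('a \<Rightarrow> 'a \<Rightarrow> real) \<Rightarrow> 'a rel \<Rightarrow> 'a \<Rightarrow> 'a \<Rightarrow> real" where
  "d1 d r x y = (if (x, y) \<in> r then d x y else 1)"

lemma openin_qtopology:
  assumes "quasi_pseudo_metric_on Y q"
  shows "openin (qtopology Y q) =
           arbitrary union_of (\<lambda>B. \<exists>x\<in>Y. \<exists>\<epsilon>>0. B = qball Y q x \<epsilon>)"
proof -
  let ?P = "\<lambda>B. \<exists>x\<in>Y. \<exists>\<epsilon>>0. B = qball Y q x \<epsilon>"
  have "(arbitrary union_of ?P) (S \<inter> T)" if ST: "?P S" "?P T" for S T
    unfolding arbitrary_union_of_alt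
  proof
    fix z assume z: "z \<in> S \<inter> T"
    obtain a e b f where ab: "a \<in> Y" "S = qball Y q a e" "b \<in> Y" "T = qball Y q b f"
      using ST by blast
    define g where "g = min (e - q a z) (f - q b z)"
    have "z \<in> Y" "0 < g" using z ab by (auto simp: qball_def g_def)
    moreover have "z \<in> qball Y q z g"
      using \<open>z \<in> Y\<close> \<open>0 < g\<close> assms by (auto simp: qball_def quasi_pseudo_metric_on_def)
    moreover have "qball Y q z g \<subseteq> S \<inter> T"
    proof
      fix w assume w: "w \<in> qball Y q z g"
      then have "w \<in> Y" by (simp add: qball_def)
      then have "q a w \<le> q a z + q z w" "q b w \<le> q b z + q z w"
        using assms ab \<open>z \<in> Y\<close> unfolding quasi_pseudo_metric_on_def by blast+
      then show "w \<in> S \<inter> T"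
        using w ab \<open>w \<in> Y\<close> by (auto simp: qball_def g_def)
    qed
    ultimately show "\<exists>U. ?P U \<and> z \<in> U \<and> U \<subseteq> S \<inter> T" by blast
  qed
  then have "istopology (arbitrary union_of ?P)"
    unfolding istopology_base_eq by blast
  then show ?thesis
    unfolding qtopology_def by (simp add: topology_inverse')
qed

lemma openin_alexandroff:
  "openin (alexandroff Y r) G \<longleftrightarrow>
     G \<subseteq> Y \<and> (\<forall>x\<in>G. \<forall>y\<in>Y. (x, y) \<in> r \<longrightarrow> y \<in> G)"
proof -
  have "istopology (\<lambda>G. G \<subseteq> Y \<and> (\<forall>x\<in>G. \<forall>y\<in>Y. (x, y) \<in> r \<longrightarrow> y \<in> G))"
    unfolding istopology_def by blast
  then show ?thesis
    unfolding alexandroff_def by (simp add: topology_inverse')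
qed

end

theory Submission
  imports Defs
begin

text \<open>The value 1 penalises unrelated pairs, and by 1-boundedness no distance exceeds it.
  Hence the triangle inequality survives: if both steps are related, transitivity reduces it to that
  of \<open>d\<close>; otherwise one summand is 1 and dominates the left side
  (\<open>quasi_pseudo_metric_on_d1\<close>). A value below 1 forces relatedness, so unit balls stay
  inside up-sets and up-sets are open (\<open>finer_topology_d1\<close>). Principal down-sets are
  complements of up-sets, hence closed in both topologies.\<close>

lemma d1_le_one:
  assumes "one_bounded_on Y d" "x \<in> Y" "y \<in> Y"
  shows "d1 d r x y \<le> 1"
  using assms by (auto simp: d1_def one_bounded_on_def)

lemma d1_nonneg:
  assumes "pseudo_metric_on Y d" "x \<in> Y" "y \<in> Y"
  shows "0 \<le> d1 d r x y"
  using assms by (auto simp: d1_def pseudo_metric_on_def)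

lemma quasi_pseudo_metric_on_d1:
  assumes "Y \<noteq> {}" and d: "pseudo_metric_on Y d" and b: "one_bounded_on Y d"
    and r: "preorder_on Y r"
  shows "quasi_pseudo_metric_on Y (d1 d r)"
  unfolding quasi_pseudo_metric_on_def
proof (intro conjI ballI)
  show "Y \<noteq> {}" by fact
next
  fix x y assume "x \<in> Y" "y \<in> Y"
  then show "0 \<le> d1 d r x y" by (rule d1_nonneg[OF d])
next
  fix x assume "x \<in> Y"
  then show "d1 d r x x = 0"
    using d r by (auto simp: d1_def pseudo_metric_on_def preorder_on_def refl_on_def)
next
  fix x y z assume Y: "x \<in> Y" "y \<in> Y" "z \<in> Y"
  show "d1 d r x z \<le> d1 d r x y + d1 d r y z"
  proof (cases "(x, y) \<in> r \<and> (y, z) \<in> r")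
    case True
    then have "(x, z) \<in> r"
      using r by (auto simp: preorder_on_def dest: transD)
    then show ?thesis
      using True d Y by (simp add: d1_def pseudo_metric_on_def)
  next
    case False
    then have "d1 d r x y = 1 \<or> d1 d r y z = 1"
      by (auto simp: d1_def)
    \<comment> \<open>The penalised summand equals 1, the other is nonnegative, and the left side is
      at most 1.\<close>
    then show ?thesis
      using d1_nonneg[OF d Y(1,2), of r] d1_nonneg[OF d Y(2,3), of r] d1_le_one[OF b Y(1,3), of r]
      by linarith
  qed
qed

text \<open>The base allows balls with any centre around a point; balls centred at the point itself
  suffice, since \<open>q x x = 0\<close> puts each centre in its own ball.\<close>

lemma openin_qtopologyI:
  assumes q: "quasi_pseudo_metric_on Y q" and "G \<subseteq> Y"
    and ball: "\<And>x. x \<in> G \<Longrightarrow> \<exists>\<epsilon>>0. qball Y q x \<epsilon> \<subseteq> G"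
  shows "openin (qtopology Y q) G"
  unfolding openin_qtopology[OF q] arbitrary_union_of_alt
proof
  fix x assume "x \<in> G"
  with ball obtain \<epsilon> where "\<epsilon> > 0" "qball Y q x \<epsilon> \<subseteq> G" by blast
  moreover have "x \<in> Y" using \<open>x \<in> G\<close> \<open>G \<subseteq> Y\<close> by blast
  moreover have "x \<in> qball Y q x \<epsilon>"
    using q \<open>x \<in> Y\<close> \<open>\<epsilon> > 0\<close> by (simp add: qball_def quasi_pseudo_metric_on_def)
  ultimately show "\<exists>U. (\<exists>x\<in>Y. \<exists>\<epsilon>>0. U = qball Y q x \<epsilon>) \<and> x \<in> U \<and> U \<subseteq> G"
    by blast
qed

lemma topspace_qtopology:
  assumes q: "quasi_pseudo_metric_on Y q"
  shows "topspace (qtopology Y q) = Y"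
proof
  show "topspace (qtopology Y q) \<subseteq> Y"
    using openin_topspace[of "qtopology Y q"]
    by (force simp: openin_qtopology[OF q] arbitrary_union_of_alt qball_def)
  have "openin (qtopology Y q) Y"
    \<comment> \<open>Any positive radius would serve, since every ball lies in
      \<open>Y\<close>.\<close>
    by (rule openin_qtopologyI[OF q]) (auto simp: qball_def intro: exI[of _ 1])
  then show "Y \<subseteq> topspace (qtopology Y q)" by (rule openin_subset)
qed

lemma topspace_alexandroff: "topspace (alexandroff Y r) = Y"
  by (auto simp: topspace_def openin_alexandroff)

text \<open>The complement of a principal down-set is an up-set: if x is not below y but is below z,
  then z below y would contradict transitivity.\<close>

lemma lower_continuous_alexandroff:
  assumes "trans r"
  shows "lower_continuous Y (alexandroff Y r) r"
  using assms
  by (auto simp: lower_continuous_def closedin_def topspace_alexandroff openin_alexandroff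
      dest: transD)

lemma lower_continuous_finer:
  assumes "finer_topology S T" "lower_continuous Y T r"
  shows "lower_continuous Y S r"
  using assms by (auto simp: finer_topology_def lower_continuous_def closedin_def)

text \<open>Every ball of radius at most 1 lies in the up-set of its centre.\<close>

lemma finer_topology_d1:
  assumes q: "quasi_pseudo_metric_on Y (d1 d r)"
  shows "finer_topology (qtopology Y (d1 d r)) (alexandroff Y r)"
  unfolding finer_topology_def
proof (intro conjI allI impI)
  show "topspace (qtopology Y (d1 d r)) = topspace (alexandroff Y r)"
    by (simp add: topspace_qtopology[OF q] topspace_alexandroff)
next
  fix G assume "openin (alexandroff Y r) G"
  then have G: "G \<subseteq> Y" "\<And>x y. x \<in> G \<Longrightarrow> y \<in> Y \<Longrightarrow> (x, y) \<in> r \<Longrightarrow> y \<in> G"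
    by (auto simp: openin_alexandroff)
  show "openin (qtopology Y (d1 d r)) G"
  proof (rule openin_qtopologyI[OF q G(1)])
    fix x assume "x \<in> G"
    then have "qball Y (d1 d r) x 1 \<subseteq> G"
      using G(2) by (auto simp: qball_def d1_def split: if_splits)
    then show "\<exists>\<epsilon>>0. qball Y (d1 d r) x \<epsilon> \<subseteq> G"
      using zero_less_one by blast
  qed
qed

text \<open>The T_1 condition is proved directly; the symmetric separation axiom of a quasi-metric
  follows from it.\<close>

lemma T1_quasi_metric_on_d1:
  assumes q: "quasi_pseudo_metric_on Y (d1 d r)" and d: "metric_on Y d"
  shows "T1_quasi_metric_on Y (d1 d r)"
proof -
  have "d1 d r x y = 0 \<longleftrightarrow> x = y" if "x \<in> Y" "y \<in> Y" for x y
  proof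
    assume "d1 d r x y = 0"
    \<comment> \<open>The value 0 is not the penalty 1, so it is a value of
      \<open>d\<close>.\<close>
    then show "x = y"
      using d that by (auto simp: d1_def metric_on_def split: if_splits)
  next
    assume "x = y"
    then show "d1 d r x y = 0"
      using q that by (simp add: quasi_pseudo_metric_on_def)
  qed
  then show ?thesis
    using q by (auto simp: T1_quasi_metric_on_def quasi_metric_on_def)
qed

theorem theorem22:
  fixes Y :: "'a set" and d :: "'a \<Rightarrow> 'a \<Rightarrow> real" and r :: "'a rel"
  assumes "Y \<noteq> {}"
    and "pseudo_metric_on Y d"
    and "one_bounded_on Y d"
    and "preorder_on Y r"
  shows "quasi_pseudo_metric_on Y (d1 d r) \<and>
         finer_topology (qtopology Y (d1 d r)) (alexandroff Y r) \<and>
         lower_continuous Y (qtopology Y (d1 d r)) r \<and>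
         (metric_on Y d \<longrightarrow> T1_quasi_metric_on Y (d1 d r))"
proof -
  have q: "quasi_pseudo_metric_on Y (d1 d r)"
    using assms by (rule quasi_pseudo_metric_on_d1)
  have "trans r"
    using assms by (simp add: preorder_on_def)
  then show ?thesis
    using q finer_topology_d1[OF q] T1_quasi_metric_on_d1[OF q]
      lower_continuous_finer[OF finer_topology_d1[OF q] lower_continuous_alexandroff]
    by blast
qed

end
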